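(* Let (S) denote the Hamiltonian system in $(x,y,z,w)$ (with $\dot x=\partial_yH$, $\dot y=-\partial_xH$, $\dot z=\partial_wH$, $\dot w=-\partial_zH$) with Hamiltonian $$H=H_{VI}(x,y,t;\alpha_0,\alpha_1,\alpha_2,\alpha_3,\alpha_4)+H_{VI}(z,w,t;\beta_0,\beta_1,\beta_2,\beta_3,\beta_4)+\frac{2(x-t)yz\{(z-1)w+\beta_2\}}{t(t-1)}.$$ Make the change of parameters and variables $$\tfrac{\alpha_0-\alpha_1}{2}=A_0,\quad \alpha_1=A_1,\quad \alpha_2=A_2,\quad \alpha_4-\beta_4=A_3,\quad \beta_2=A_4,\quad \beta_4=A_5,\quad \tfrac{\beta_3-\beta_4}{2}=A_6,$$ $$X=\frac1x,\quad Y=-(xy+\alpha_2)x,\quad Z=\frac1z,\quad W=-(zw+\beta_2)z$$ from $\alpha_0,\alpha_1,\alpha_2,\alpha_4,\beta_2,\beta_3,\beta_4,x,y,z,w$ to $A_0,\dots,A_6,X,Y,Z,W$. Then (S) can also be written in the new variables $X,Y,Z,W$ and parameters $A_0,\dots,A_6$ as a Hamiltonian system, and this new system is the Hamiltonian system in $(X,Y,Z,W)$ with Hamiltonian \begin{align*} &\tilde H_{VI}(X,Y,t;2A_0+A_1,A_1,A_2,A_3+A_5+2A_6,A_3+2A_4+A_5)\\ &+\tilde H_{VI}(Z,W,t;2A_0+A_1+2A_2+A_3,A_1+A_3,A_4,A_5+2A_6,A_5)+\frac{2X\{(tX-1)Y+tA_2\}(Z-1)W}{t(t-1)}. \end{a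lign*}
   Context: For parameters with $\delta_0+\delta_1+2\delta_2+\delta_3+\delta_4=1$, $$H_{VI}(q,p,t;\delta_0,\dots,\delta_4)=\tfrac{1}{t(t-1)}\big[p^2(q-t)(q-1)q-\{(\delta_0-1)(q-1)q+\delta_3(q-t)q+\delta_4(q-t)(q-1)\}p+\delta_2(\delta_1+\delta_2)q\big],$$ $$\tilde H_{VI}(Q,P,t;\delta_0,\dots,\delta_4)=\tfrac{1}{t(t-1)}\big[P^2(tQ-1)(Q-1)Q-\{(\delta_0-1)t(Q-1)Q+\delta_1(Q-1)(tQ-1)+\delta_3Q(tQ-1)\}P+\delta_2(\delta_2+\delta_4)tQ\big].$$ The free parameters of (S) are complex numbers $\alpha_0,\alpha_1,\alpha_2,\alpha_4,\beta_2,\beta_3,\beta_4$ with $\alpha_0+\alpha_1+2\alpha_2+2(\alpha_4-\beta_4)+2\beta_2+\beta_3+\beta_4=1$ (equivalently $A_0+\cdots+A_6=\frac12$); the other parameters are determined by $\alpha_3=\alpha_4-\beta_4+2\beta_2+\beta_3$, $\beta_0=\alpha_0+\alpha_4-\beta_4$, $\beta_1=\alpha_1+2\alpha_2+\alpha_4-\beta_4$. *)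

theory Defs
  imports "HOL-Analysis.Analysis"
begin

type_synonym hamiltonian =
  "complex \<Rightarrow> complex \<Rightarrow> complex \<Rightarrow> complex \<Rightarrow> complex \<Rightarrow> complex"

text \<open>
  A Hamiltonian \<open>H x y z w t\<close> has canonical pairs \<open>(x, y)\<close> and \<open>(z, w)\<close> and may depend on the
  time \<open>t\<close>, which is complex.  The partial derivatives are taken with \<open>deriv\<close>, which is
  meaningful for the Hamiltonians below since they are polynomial in \<open>x, y, z, w\<close>.
\<close>

definition solves_hamiltonian_system ::
  "hamiltonian \<Rightarrow> complex set \<Rightarrow> (complex \<Rightarrow> complex) \<Rightarrow> (complex \<Rightarrow> complex) \<Rightarrow>
     (complex \<Rightarrow> complex) \<Rightarrow> (complex \<Rightarrow> complex) \<Rightarrow> bool"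
where
  "solves_hamiltonian_system H U x y z w \<longleftrightarrow>
     (\<forall>t\<in>U.
        (x has_field_derivative deriv (\<lambda>v. H (x t) v (z t) (w t) t) (y t)) (at t) \<and>
        (y has_field_derivative - deriv (\<lambda>v. H v (y t) (z t) (w t) t) (x t)) (at t) \<and>
        (z has_field_derivative deriv (\<lambda>v. H (x t) (y t) (z t) v t) (w t)) (at t) \<and>
        (w has_field_derivative - deriv (\<lambda>v. H (x t) (y t) v (w t) t) (z t)) (at t))"

text \<open>
  Both Hamiltonians are only used with parameters satisfying
  \<open>\<delta>0 + \<delta>1 + 2 * \<delta>2 + \<delta>3 + \<delta>4 = 1\<close>.
\<close>

definition H_VI :: "complex \<Rightarrow> complex \<Rightarrow> complex \<Rightarrow>
    complex \<Rightarrow> complex \<Rightarrow> complex \<Rightarrow> complex \<Rightarrow> complex \<Rightarrow> complex"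
where
  "H_VI q p t \<delta>0 \<delta>1 \<delta>2 \<delta>3 \<delta>4 =
     1 / (t * (t - 1)) *
     (p\<^sup>2 * (q - t) * (q - 1) * q
      - ((\<delta>0 - 1) * (q - 1) * q + \<delta>3 * (q - t) * q + \<delta>4 * (q - t) * (q - 1)) * p
      + \<delta>2 * (\<delta>1 + \<delta>2) * q)"

definition H_VI_tilde :: "complex \<Rightarrow> complex \<Rightarrow> complex \<Rightarrow>
    complex \<Rightarrow> complex \<Rightarrow> complex \<Rightarrow> complex \<Rightarrow> complex \<Rightarrow> complex"
where
  "H_VI_tilde Q P t \<delta>0 \<delta>1 \<delta>2 \<delta>3 \<delta>4 =
     1 / (t * (t - 1)) *
     (P\<^sup>2 * (t * Q - 1) * (Q - 1) * Q
      - ((\<delta>0 - 1) * t * (Q - 1) * Q + \<delta>1 * (Q - 1) * (t * Q - 1) + \<delta>3 * Q * (t * Q - 1)) * P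
      + \<delta>2 * (\<delta>2 + \<delta>4) * t * Q)"

definition H_S :: "complex \<Rightarrow> complex \<Rightarrow> complex \<Rightarrow> complex \<Rightarrow>
    complex \<Rightarrow> complex \<Rightarrow> complex \<Rightarrow> hamiltonian"
where
  "H_S \<alpha>0 \<alpha>1 \<alpha>2 \<alpha>4 \<beta>2 \<beta>3 \<beta>4 x y z w t =
     (let \<alpha>3 = \<alpha>4 - \<beta>4 + 2 * \<beta>2 + \<beta>3;
          \<beta>0 = \<alpha>0 + \<alpha>4 - \<beta>4;
          \<beta>1 = \<alpha>1 + 2 * \<alpha>2 + \<alpha>4 - \<beta>4
      in H_VI x y t \<alpha>0 \<alpha>1 \<alpha>2 \<alpha>3 \<alpha>4 + H_VI z w t \<beta>0 \<beta>1 \<beta>2 \<beta>3 \<beta>4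
         + 2 * (x - t) * y * z * ((z - 1) * w + \<beta>2) / (t * (t - 1)))"

definition H_S_tilde :: "complex \<Rightarrow> complex \<Rightarrow> complex \<Rightarrow> complex \<Rightarrow>
    complex \<Rightarrow> complex \<Rightarrow> complex \<Rightarrow> hamiltonian"
where
  "H_S_tilde A0 A1 A2 A3 A4 A5 A6 X Y Z W t =
     H_VI_tilde X Y t (2 * A0 + A1) A1 A2 (A3 + A5 + 2 * A6) (A3 + 2 * A4 + A5)
     + H_VI_tilde Z W t (2 * A0 + A1 + 2 * A2 + A3) (A1 + A3) A4 (A5 + 2 * A6) A5
     + 2 * X * ((t * X - 1) * Y + t * A2) * (Z - 1) * W / (t * (t - 1))"

text \<open>Tuples of parameters are ordered \<open>(\<alpha>0, \<alpha>1, \<alpha>2, \<alpha>4, \<beta>2, \<beta>3, \<beta>4)\<close> and \<open>(A0, \<dots>, A6)\<close>.\<close>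

type_synonym params =
  "complex \<times> complex \<times> complex \<times> complex \<times> complex \<times> complex \<times> complex"

definition S_params :: "params set" where
  "S_params = {(\<alpha>0, \<alpha>1, \<alpha>2, \<alpha>4, \<beta>2, \<beta>3, \<beta>4).
     \<alpha>0 + \<alpha>1 + 2 * \<alpha>2 + 2 * (\<alpha>4 - \<beta>4) + 2 * \<beta>2 + \<beta>3 + \<beta>4 = 1}"

definition A_params :: "params set" where
  "A_params = {(A0, A1, A2, A3, A4, A5, A6). A0 + A1 + A2 + A3 + A4 + A5 + A6 = 1 / 2}"

fun change_params :: "params \<Rightarrow> params" where
  "change_params (\<alpha>0, \<alpha>1, \<alpha>2, \<alpha>4, \<beta>2, \<beta>3, \<beta>4) =
     ((\<alpha>0 - \<alpha>1) / 2, \<alpha>1, \<alpha>2, \<alpha>4 - \<beta>4, \<beta>2, \<beta>4, (\<beta>3 - \<beta>4) / 2)"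

type_synonym phase = "complex \<times> complex \<times> complex \<times> complex"

text \<open>The change of variables is only defined away from \<open>x = 0\<close> and \<open>z = 0\<close>.\<close>

definition chart :: "phase set" where
  "chart = {(x, y, z, w). x \<noteq> 0 \<and> z \<noteq> 0}"

fun change_vars :: "complex \<Rightarrow> complex \<Rightarrow> phase \<Rightarrow> phase" where
  "change_vars \<alpha>2 \<beta>2 (x, y, z, w) =
     (1 / x, - (x * y + \<alpha>2) * x, 1 / z, - (z * w + \<beta>2) * z)"

end

theory Submission
  imports Defs
begin

text \<open>
  The change of variables is a time-independent involution that preserves
  \<open>dx \<and> dy + dz \<and> dw\<close>, so it carries a Hamiltonian system to a Hamiltonian system with the
  transformed Hamiltonian.  Substituting it into \<open>H_S_tilde\<close> gives \<open>H_S\<close> up to a summand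
  depending on \<open>t\<close> alone, which does not affect the equations of motion.
\<close>

section \<open>Complex differentiability in the phase variables\<close>

text \<open>
  Differentiability is expressed by the chain rule along arbitrary curves because
  \<open>has_derivative\<close> on a product of copies of the complex numbers is only real linear.
\<close>

definition has_phase_gradient ::
  "(complex \<Rightarrow> complex \<Rightarrow> complex \<Rightarrow> complex \<Rightarrow> complex) \<Rightarrow>
     complex \<Rightarrow> complex \<Rightarrow> complex \<Rightarrow> complex \<Rightarrow> complex \<Rightarrow> complex \<Rightarrow> complex \<Rightarrow> complex \<Rightarrow> bool"
where
  "has_phase_gradient F a b c d x y z w \<longleftrightarrow>
     (\<forall>f g h k f' g' h' k' s.
        f s = x \<longrightarrow> g s = y \<longrightarrow> h s = z \<longrightarrow> k s = w \<longrightarrow>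
        (f has_field_derivative f') (at s) \<longrightarrow> (g has_field_derivative g') (at s) \<longrightarrow>
        (h has_field_derivative h') (at s) \<longrightarrow> (k has_field_derivative k') (at s) \<longrightarrow>
        ((\<lambda>r. F (f r) (g r) (h r) (k r)) has_field_derivative
           a * f' + b * g' + c * h' + d * k') (at s))"

text \<open>Hiding the gradient lets differentiability be proved by introduction rules alone: the
  partial derivatives of the two Hamiltonians are never computed explicitly.\<close>

definition phase_differentiable ::
  "(complex \<Rightarrow> complex \<Rightarrow> complex \<Rightarrow> complex \<Rightarrow> complex) \<Rightarrow>
     complex \<Rightarrow> complex \<Rightarrow> complex \<Rightarrow> complex \<Rightarrow> bool"
where
  "phase_differentiable F x y z w \<longleftrightarrow> (\<exists>a b c d. has_phase_gradient F a b c d x y z w)"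

text \<open>The separate equation for \<open>e\<close> lets each use state the derivative in the
  form it wants.\<close>

lemma has_phase_gradient_chain:
  assumes "has_phase_gradient F a b c d x y z w"
    and "f s = x" "g s = y" "h s = z" "k s = w"
    and "(f has_field_derivative f') (at s)" "(g has_field_derivative g') (at s)"
      "(h has_field_derivative h') (at s)" "(k has_field_derivative k') (at s)"
    and "a * f' + b * g' + c * h' + d * k' = e"
  shows "((\<lambda>r. F (f r) (g r) (h r) (k r)) has_field_derivative e) (at s)"
  using assms unfolding has_phase_gradient_def by blast

text \<open>A partial derivative is the chain rule along a coordinate line: one coordinate moves
  with speed 1 and the other three are constant.\<close>

lemma has_phase_gradient_partials:
  assumes "has_phase_gradient F a b c d x y z w"
  shows "deriv (\<lambda>v. F v y z w) x = a" "deriv (\<lambda>v. F x v z w) y = b"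
    "deriv (\<lambda>v. F x y v w) z = c" "deriv (\<lambda>v. F x y z v) w = d"
  using has_phase_gradient_chain[OF assms, of "\<lambda>v. v" x "\<lambda>_. y" "\<lambda>_. z" "\<lambda>_. w" 1 0 0 0 a]
    has_phase_gradient_chain[OF assms, of "\<lambda>_. x" y "\<lambda>v. v" "\<lambda>_. z" "\<lambda>_. w" 0 1 0 0 b]
    has_phase_gradient_chain[OF assms, of "\<lambda>_. x" z "\<lambda>_. y" "\<lambda>v. v" "\<lambda>_. w" 0 0 1 0 c]
    has_phase_gradient_chain[OF assms, of "\<lambda>_. x" w "\<lambda>_. y" "\<lambda>_. z" "\<lambda>v. v" 0 0 0 1 d]
  by (auto intro: DERIV_imp_deriv)

lemma has_phase_gradient_const: "has_phase_gradient (\<lambda>x y z w. e) 0 0 0 0 x y z w"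
  by (simp add: has_phase_gradient_def)

lemma has_phase_gradient_proj:
  "has_phase_gradient (\<lambda>x y z w. x) 1 0 0 0 x y z w"
  "has_phase_gradient (\<lambda>x y z w. y) 0 1 0 0 x y z w"
  "has_phase_gradient (\<lambda>x y z w. z) 0 0 1 0 x y z w"
  "has_phase_gradient (\<lambda>x y z w. w) 0 0 0 1 x y z w"
  by (simp_all add: has_phase_gradient_def)

lemma has_phase_gradient_add:
  assumes "has_phase_gradient F a b c d x y z w" "has_phase_gradient G a' b' c' d' x y z w"
  shows "has_phase_gradient (\<lambda>x y z w. F x y z w + G x y z w)
    (a + a') (b + b') (c + c') (d + d') x y z w"
  unfolding has_phase_gradient_def
proof (intro allI impI)
  fix f g h k f' g' h' k' s
  assume curve: "f s = x" "g s = y" "h s = z" "k s = w"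
    "(f has_field_derivative f') (at s)" "(g has_field_derivative g') (at s)"
    "(h has_field_derivative h') (at s)" "(k has_field_derivative k') (at s)"
  from DERIV_add[OF assms[THEN has_phase_gradient_chain, OF curve refl]]
  show "((\<lambda>r. F (f r) (g r) (h r) (k r) + G (f r) (g r) (h r) (k r)) has_field_derivative
      (a + a') * f' + (b + b') * g' + (c + c') * h' + (d + d') * k') (at s)"
    by (simp add: algebra_simps)
qed

lemma has_phase_gradient_mult:
  assumes "has_phase_gradient F a b c d x y z w" "has_phase_gradient G a' b' c' d' x y z w"
  shows "has_phase_gradient (\<lambda>x y z w. F x y z w * G x y z w)
    (a * G x y z w + a' * F x y z w) (b * G x y z w + b' * F x y z w)
    (c * G x y z w + c' * F x y z w) (d * G x y z w + d' * F x y z w) x y z w"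
  unfolding has_phase_gradient_def
proof (intro allI impI)
  fix f g h k f' g' h' k' s
  assume curve: "f s = x" "g s = y" "h s = z" "k s = w"
    "(f has_field_derivative f') (at s)" "(g has_field_derivative g') (at s)"
    "(h has_field_derivative h') (at s)" "(k has_field_derivative k') (at s)"
  from DERIV_mult[OF assms[THEN has_phase_gradient_chain, OF curve refl]]
  show "((\<lambda>r. F (f r) (g r) (h r) (k r) * G (f r) (g r) (h r) (k r)) has_field_derivative
      (a * G x y z w + a' * F x y z w) * f' + (b * G x y z w + b' * F x y z w) * g' +
      (c * G x y z w + c' * F x y z w) * h' + (d * G x y z w + d' * F x y z w) * k') (at s)"
    by (simp add: curve algebra_simps)
qed

lemma phase_differentiable_const: "phase_differentiable (\<lambda>x y z w. e) x y z w"
  unfolding phase_differentiable_def using has_phase_gradient_const by blast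

lemma phase_differentiable_proj:
  "phase_differentiable (\<lambda>x y z w. x) x y z w"
  "phase_differentiable (\<lambda>x y z w. y) x y z w"
  "phase_differentiable (\<lambda>x y z w. z) x y z w"
  "phase_differentiable (\<lambda>x y z w. w) x y z w"
  unfolding phase_differentiable_def using has_phase_gradient_proj by blast+

lemma phase_differentiable_add:
  assumes "phase_differentiable F x y z w" "phase_differentiable G x y z w"
  shows "phase_differentiable (\<lambda>x y z w. F x y z w + G x y z w) x y z w"
  using assms has_phase_gradient_add unfolding phase_differentiable_def by blast

lemma phase_differentiable_mult:
  assumes "phase_differentiable F x y z w" "phase_differentiable G x y z w"
  shows "phase_differentiable (\<lambda>x y z w. F x y z w * G x y z w) x y z w"
  using assms has_phase_gradient_mult unfolding phase_differentiable_def by blast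

lemma phase_differentiable_diff:
  assumes "phase_differentiable F x y z w" "phase_differentiable G x y z w"
  shows "phase_differentiable (\<lambda>x y z w. F x y z w - G x y z w) x y z w"
  using phase_differentiable_add[OF assms(1)
      phase_differentiable_mult[OF phase_differentiable_const[of "-1"] assms(2)]]
  by simp

lemmas phase_differentiable_intros =
  phase_differentiable_const phase_differentiable_proj phase_differentiable_add
  phase_differentiable_diff phase_differentiable_mult

text \<open>For fixed \<open>t\<close> the function is a polynomial in the phase variables: after
  \<open>divide_inverse\<close> the denominator is just a constant factor, so no condition on
  \<open>t\<close> arises.\<close>

lemma phase_differentiable_H_S:
  "phase_differentiable (\<lambda>x y z w. H_S \<alpha>0 \<alpha>1 \<alpha>2 \<alpha>4 \<beta>2 \<beta>3 \<beta>4 x y z w t) x y z w"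
  unfolding H_S_def H_VI_def Let_def divide_inverse power2_eq_square
  by (intro phase_differentiable_intros)

lemma phase_differentiable_H_S_tilde:
  "phase_differentiable (\<lambda>x y z w. H_S_tilde A0 A1 A2 A3 A4 A5 A6 x y z w t) x y z w"
  unfolding H_S_tilde_def H_VI_tilde_def divide_inverse power2_eq_square
  by (intro phase_differentiable_intros)

section \<open>Transport of Hamiltonian systems\<close>

text \<open>Both systems are expressed through the gradient \<open>(a, b, c, d)\<close> of
  \<open>H\<close> at the old point and then compared. Leaving \<open>H\<close>, \<open>K\<close>
  and \<open>e\<close> arbitrary lets one lemma serve both directions, the map being its own
  inverse. No regularity of \<open>e\<close> is needed, as \<open>t\<close> is frozen in every
  partial derivative.\<close>

lemma solves_hamiltonian_system_transport:
  assumes U: "open U"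
    and diff: "\<And>t x y z w. t \<in> U \<Longrightarrow> phase_differentiable (\<lambda>x y z w. H x y z w t) x y z w"
    and K: "\<And>t X Y Z W. t \<in> U \<Longrightarrow> X \<noteq> 0 \<Longrightarrow> Z \<noteq> 0 \<Longrightarrow>
      K X Y Z W t = H (1 / X) (- (X * Y + \<mu>) * X) (1 / Z) (- (Z * W + \<nu>) * Z) t + e t"
    and nz: "\<And>t. t \<in> U \<Longrightarrow> x t \<noteq> 0" "\<And>t. t \<in> U \<Longrightarrow> z t \<noteq> 0"
    and X: "\<And>t. t \<in> U \<Longrightarrow> X t = 1 / x t"
    and Y: "\<And>t. t \<in> U \<Longrightarrow> Y t = - (x t * y t + \<mu>) * x t"
    and Z: "\<And>t. t \<in> U \<Longrightarrow> Z t = 1 / z t"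
    and W: "\<And>t. t \<in> U \<Longrightarrow> W t = - (z t * w t + \<nu>) * z t"
    and sol: "solves_hamiltonian_system H U x y z w"
  shows "solves_hamiltonian_system K U X Y Z W"
  unfolding solves_hamiltonian_system_def
proof (intro ballI)
  fix t assume t: "t \<in> U"
  note nz = nz[OF t]
  obtain a b c d where grad:
    "has_phase_gradient (\<lambda>x y z w. H x y z w t) a b c d (x t) (y t) (z t) (w t)"
    using diff[OF t, of "x t" "y t" "z t" "w t"] unfolding phase_differentiable_def by blast
  have "has_phase_gradient (\<lambda>x y z w. H x y z w t + e t) a b c d (x t) (y t) (z t) (w t)"
    using has_phase_gradient_add[OF grad has_phase_gradient_const[of "e t"]] by simp
  note chain = has_phase_gradient_chain[OF this]
  have eqs: "(x has_field_derivative b) (at t)" "(y has_field_derivative - a) (at t)"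
      "(z has_field_derivative d) (at t)" "(w has_field_derivative - c) (at t)"
    using bspec[OF sol[unfolded solves_hamiltonian_system_def] t]
    by (simp_all add: has_phase_gradient_partials[OF grad])
  have XZ_nz: "X t \<noteq> 0" "Z t \<noteq> 0"
    using nz t by (simp_all add: X Z)
  \<comment> \<open>By the involution the formulas in \<open>X, Y, Z, W\<close> return the old
    point, which is where the gradient of \<open>H\<close> is known.\<close>
  have inv: "1 / X t = x t" "- (X t * Y t + \<mu>) * X t = y t"
      "1 / Z t = z t" "- (Z t * W t + \<nu>) * Z t = w t"
    using nz t by (simp_all add: X Y Z W field_simps)
  \<comment> \<open>The formula for \<open>K\<close> is assumed only for nonzero \<open>X\<close>
    and \<open>Z\<close>; as differentiation is local, this open set suffices when \<open>X\<close>
    or \<open>Z\<close> varies.\<close>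
  have open_nz: "open (- {0 :: complex})"
    by (simp add: open_Compl)
  have KX: "deriv (\<lambda>v. K v (Y t) (Z t) (W t) t) (X t) = - a * (x t)\<^sup>2 - b * (2 * X t * Y t + \<mu>)"
  proof (rule DERIV_imp_deriv, rule has_field_derivative_transform_within_open[OF _ open_nz])
    show "((\<lambda>v. H (1 / v) (- (v * Y t + \<mu>) * v) (1 / Z t) (- (Z t * W t + \<nu>) * Z t) t + e t)
        has_field_derivative - a * (x t)\<^sup>2 - b * (2 * X t * Y t + \<mu>)) (at (X t))"
      by (rule chain[of "\<lambda>v. 1 / v" "X t" "\<lambda>v. - (v * Y t + \<mu>) * v" "\<lambda>_. 1 / Z t"
            "\<lambda>_. - (Z t * W t + \<nu>) * Z t" "- (x t)\<^sup>2" "- (2 * X t * Y t + \<mu>)" 0 0])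
        (use inv XZ_nz nz in \<open>auto intro!: derivative_eq_intros
          simp: X[OF t] power2_eq_square algebra_simps\<close>)
  qed (use K[OF t] XZ_nz in auto)
  \<comment> \<open>Here \<open>X\<close> and \<open>Z\<close> stay fixed and nonzero, so
    \<open>K\<close> can be rewritten for every \<open>v\<close> at once.\<close>
  have KY: "deriv (\<lambda>v. K (X t) v (Z t) (W t) t) (Y t) = - b * (X t)\<^sup>2"
    unfolding K[OF t XZ_nz]
    by (rule DERIV_imp_deriv, rule chain[of "\<lambda>_. 1 / X t" "Y t" "\<lambda>v. - (X t * v + \<mu>) * X t"
          "\<lambda>_. 1 / Z t" "\<lambda>_. - (Z t * W t + \<nu>) * Z t" 0 "- (X t)\<^sup>2" 0 0])
      (use inv in \<open>auto intro!: derivative_eq_intros simp: power2_eq_square\<close>)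
  have KZ: "deriv (\<lambda>v. K (X t) (Y t) v (W t) t) (Z t) = - c * (z t)\<^sup>2 - d * (2 * Z t * W t + \<nu>)"
  proof (rule DERIV_imp_deriv, rule has_field_derivative_transform_within_open[OF _ open_nz])
    show "((\<lambda>v. H (1 / X t) (- (X t * Y t + \<mu>) * X t) (1 / v) (- (v * W t + \<nu>) * v) t + e t)
        has_field_derivative - c * (z t)\<^sup>2 - d * (2 * Z t * W t + \<nu>)) (at (Z t))"
      by (rule chain[of "\<lambda>_. 1 / X t" "Z t" "\<lambda>_. - (X t * Y t + \<mu>) * X t" "\<lambda>v. 1 / v"
            "\<lambda>v. - (v * W t + \<nu>) * v" 0 0 "- (z t)\<^sup>2" "- (2 * Z t * W t + \<nu>)"])
        (use inv XZ_nz nz in \<open>auto intro!: derivative_eq_intros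
          simp: Z[OF t] power2_eq_square algebra_simps\<close>)
  qed (use K[OF t] XZ_nz in auto)
  have KW: "deriv (\<lambda>v. K (X t) (Y t) (Z t) v t) (W t) = - d * (Z t)\<^sup>2"
    unfolding K[OF t XZ_nz]
    by (rule DERIV_imp_deriv, rule chain[of "\<lambda>_. 1 / X t" "W t"
          "\<lambda>_. - (X t * Y t + \<mu>) * X t" "\<lambda>_. 1 / Z t" "\<lambda>v. - (Z t * v + \<nu>) * Z t"
          0 0 0 "- (Z t)\<^sup>2"])
      (use inv in \<open>auto intro!: derivative_eq_intros simp: power2_eq_square\<close>)
  \<comment> \<open>The new curves are known only on \<open>U\<close>; each is differentiated
    through its formula, and openness of \<open>U\<close> carries the result over.\<close>
  have "((\<lambda>t. 1 / x t) has_field_derivative - b * (X t)\<^sup>2) (at t)"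
    using eqs(1) nz t by (auto intro!: derivative_eq_intros simp: X power2_eq_square)
  then have DX: "(X has_field_derivative - b * (X t)\<^sup>2) (at t)"
    by (rule has_field_derivative_transform_within_open[OF _ U t]) (simp add: X)
  have "((\<lambda>t. 1 / z t) has_field_derivative - d * (Z t)\<^sup>2) (at t)"
    using eqs(3) nz t by (auto intro!: derivative_eq_intros simp: Z power2_eq_square)
  then have DZ: "(Z has_field_derivative - d * (Z t)\<^sup>2) (at t)"
    by (rule has_field_derivative_transform_within_open[OF _ U t]) (simp add: Z)
  \<comment> \<open>The product rule gives \<open>a x^2 - b (2 x y + mu)\<close>. It matches the
    derivative of \<open>K\<close> because \<open>X Y = -(x y + mu)\<close>, hence
    \<open>2 X Y + mu = -(2 x y + mu)\<close>.\<close>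
  have "((\<lambda>t. - (x t * y t + \<mu>) * x t) has_field_derivative
      - (- a * (x t)\<^sup>2 - b * (2 * X t * Y t + \<mu>))) (at t)"
    using nz by (auto intro!: derivative_eq_intros eqs
        simp: X[OF t] Y[OF t] power2_eq_square algebra_simps)
  then have DY: "(Y has_field_derivative - (- a * (x t)\<^sup>2 - b * (2 * X t * Y t + \<mu>))) (at t)"
    by (rule has_field_derivative_transform_within_open[OF _ U t]) (simp add: Y)
  have "((\<lambda>t. - (z t * w t + \<nu>) * z t) has_field_derivative
      - (- c * (z t)\<^sup>2 - d * (2 * Z t * W t + \<nu>))) (at t)"
    using nz by (auto intro!: derivative_eq_intros eqs
        simp: Z[OF t] W[OF t] power2_eq_square algebra_simps)
  then have DW: "(W has_field_derivative - (- c * (z t)\<^sup>2 - d * (2 * Z t * W t + \<nu>))) (at t)"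
    by (rule has_field_derivative_transform_within_open[OF _ U t]) (simp add: W)
  show "(X has_field_derivative deriv (\<lambda>v. K (X t) v (Z t) (W t) t) (Y t)) (at t) \<and>
      (Y has_field_derivative - deriv (\<lambda>v. K v (Y t) (Z t) (W t) t) (X t)) (at t) \<and>
      (Z has_field_derivative deriv (\<lambda>v. K (X t) (Y t) (Z t) v t) (W t)) (at t) \<and>
      (W has_field_derivative - deriv (\<lambda>v. K (X t) (Y t) v (W t) t) (Z t)) (at t)"
    unfolding KX KY KZ KW using DX DY DZ DW by blast
qed

section \<open>The change of variables and parameters\<close>

text \<open>Since \<open>X Y = -(x y + mu)\<close>, we get \<open>X Y + mu = -x y\<close>, so
  \<open>-(X Y + mu) X = y\<close>; the second pair is alike.\<close>

lemma change_vars_involution: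
  assumes "p \<in> chart"
  shows "change_vars \<mu> \<nu> (change_vars \<mu> \<nu> p) = p"
  using assms by (auto simp: chart_def field_simps)

lemma change_vars_chart: "change_vars \<mu> \<nu> ` chart \<subseteq> chart"
  by (auto simp: chart_def)

lemma bij_betw_change_vars: "bij_betw (change_vars \<mu> \<nu>) chart chart"
  by (rule bij_betw_byWitness[where f' = "change_vars \<mu> \<nu>"])
    (use change_vars_involution change_vars_chart in blast)+

text \<open>Under the substitution the left side of the constraint in \<open>S_params\<close>
  becomes twice the sum of the \<open>A\<close>s, so the value 1 corresponds to 1/2.\<close>

lemma bij_betw_change_params: "bij_betw change_params S_params A_params"
  by (rule bij_betw_byWitness[where f' = "\<lambda>(A0, A1, A2, A3, A4, A5, A6).
        (2 * A0 + A1, A1, A2, A3 + A5, A4, A5 + 2 * A6, A5)"])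
    (auto simp: S_params_def A_params_def field_simps)

text \<open>The value of \<open>H_S_tilde - H_S\<close>, read off at the point \<open>x = z = 1\<close>, \<open>Y = W = 0\<close>.\<close>

definition H_S_shift ::
  "complex \<Rightarrow> complex \<Rightarrow> complex \<Rightarrow> complex \<Rightarrow> complex \<Rightarrow> complex \<Rightarrow> complex \<Rightarrow> complex"
where
  "H_S_shift A1 A2 A3 A4 A5 A6 t =
     (t * (A2 * (A2 + A3 + 2 * A4 + A5) + A4 * (A4 + A5))
      - A2 * (A1 + A2) - A4 * (A1 + 2 * A2 + A3 + A4)
      - (1 - t) * (A2 * (A3 + 2 * A4 + A5 + 2 * A6) + A4 * (A5 + 2 * A6) - 2 * A2 * A4))
     / (t * (t - 1))"

text \<open>With \<open>1 / x\<close> and \<open>1 / z\<close> as new symbols tied by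
  \<open>x * X = 1\<close> and \<open>z * Z = 1\<close>, and \<open>A0\<close> eliminated by the
  parameter constraint, this is a polynomial identity modulo those two relations.\<close>

lemma H_S_tilde_change_vars:
  fixes x y z w t :: complex
  assumes "x \<noteq> 0" "z \<noteq> 0" and A: "(A0, A1, A2, A3, A4, A5, A6) \<in> A_params"
  shows "H_S_tilde A0 A1 A2 A3 A4 A5 A6 (1 / x) (- (x * y + A2) * x) (1 / z) (- (z * w + A4) * z) t =
     H_S (2 * A0 + A1) A1 A2 (A3 + A5) A4 (A5 + 2 * A6) A5 x y z w t + H_S_shift A1 A2 A3 A4 A5 A6 t"
proof -
  define X Z where "X = 1 / x" and "Z = 1 / z"
  then have XZ: "1 / x = X" "1 / z = Z" "x * X = 1" "z * Z = 1"
    using assms by simp_all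
  have A0: "A0 = 1 / 2 - A1 - A2 - A3 - A4 - A5 - A6"
    using A by (simp add: A_params_def algebra_simps)
  \<comment> \<open>Both sides are collected over the common denominator and only numerators are
    compared, so \<open>t = 0\<close> and \<open>t = 1\<close> need no separate treatment.\<close>
  show ?thesis
    unfolding XZ(1,2) H_S_tilde_def H_S_def H_VI_def H_VI_tilde_def H_S_shift_def Let_def A0
      times_divide_eq_left mult_1_left add_divide_distrib[symmetric]
    by (rule arg_cong[where f = "\<lambda>u. u / (t * (t - 1))"]) (use XZ(3,4) in algebra)
qed

theorem theorem4p2:
  fixes \<alpha>0 \<alpha>1 \<alpha>2 \<alpha>4 \<beta>2 \<beta>3 \<beta>4 A0 A1 A2 A3 A4 A5 A6 :: complex
    and U :: "complex set"
    and x y z w X Y Z W :: "complex \<Rightarrow> complex"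
  assumes params: "(\<alpha>0, \<alpha>1, \<alpha>2, \<alpha>4, \<beta>2, \<beta>3, \<beta>4) \<in> S_params"
    and new_params: "(A0, A1, A2, A3, A4, A5, A6) = change_params (\<alpha>0, \<alpha>1, \<alpha>2, \<alpha>4, \<beta>2, \<beta>3, \<beta>4)"
    and time_domain: "open U" "0 \<notin> U" "1 \<notin> U"
    and dom: "\<And>t. t \<in> U \<Longrightarrow> (x t, y t, z t, w t) \<in> chart"
    and new_vars: "\<And>t. t \<in> U \<Longrightarrow> (X t, Y t, Z t, W t) = change_vars \<alpha>2 \<beta>2 (x t, y t, z t, w t)"
  shows "bij_betw change_params S_params A_params \<and>
    bij_betw (change_vars \<alpha>2 \<beta>2) chart chart \<and>
    (solves_hamiltonian_system (H_S \<alpha>0 \<alpha>1 \<alpha>2 \<alpha>4 \<beta>2 \<beta>3 \<beta>4) U x y z w \<longleftrightarrow>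
     solves_hamiltonian_system (H_S_tilde A0 A1 A2 A3 A4 A5 A6) U X Y Z W)"
proof (intro conjI iffI)
  \<comment> \<open>Inverting the parameter change allows both Hamiltonians to be written in the
    \<open>A\<close>s.\<close>
  have old_params: "\<alpha>0 = 2 * A0 + A1" "\<alpha>1 = A1" "\<alpha>2 = A2" "\<alpha>4 = A3 + A5" "\<beta>2 = A4"
      "\<beta>3 = A5 + 2 * A6" "\<beta>4 = A5"
    using new_params by (auto simp: field_simps)
  have A: "(A0, A1, A2, A3, A4, A5, A6) \<in> A_params"
    using bij_betw_apply[OF bij_betw_change_params params] by (simp only: new_params)
  have nz: "x t \<noteq> 0" "z t \<noteq> 0" if "t \<in> U" for t
    using dom[OF that] by (simp_all add: chart_def)
  have new: "X t = 1 / x t" "Y t = - (x t * y t + A2) * x t"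
      "Z t = 1 / z t" "W t = - (z t * w t + A4) * z t" if "t \<in> U" for t
    using new_vars[OF that] by (simp_all add: old_params)
  have old: "x t = 1 / X t" "y t = - (X t * Y t + A2) * X t"
      "z t = 1 / Z t" "w t = - (Z t * W t + A4) * Z t" if "t \<in> U" for t
    unfolding new[OF that] using nz[OF that] by (simp_all add: field_simps)
  have nz': "X t \<noteq> 0" "Z t \<noteq> 0" if "t \<in> U" for t
    using nz[OF that] new[OF that] by simp_all
  let ?H = "H_S (2 * A0 + A1) A1 A2 (A3 + A5) A4 (A5 + 2 * A6) A5"
  let ?K = "H_S_tilde A0 A1 A2 A3 A4 A5 A6"
  let ?e = "H_S_shift A1 A2 A3 A4 A5 A6"
  show "bij_betw change_params S_params A_params"
    by (rule bij_betw_change_params)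
  show "bij_betw (change_vars \<alpha>2 \<beta>2) chart chart"
    by (rule bij_betw_change_vars)
  show "solves_hamiltonian_system ?K U X Y Z W"
    if sol: "solves_hamiltonian_system (H_S \<alpha>0 \<alpha>1 \<alpha>2 \<alpha>4 \<beta>2 \<beta>3 \<beta>4) U x y z w"
  proof (rule solves_hamiltonian_system_transport[OF time_domain(1) _ _ nz new])
    fix t X Y Z W :: complex
    assume "X \<noteq> 0" "Z \<noteq> 0"
    then have "(X, Y, Z, W) \<in> chart"
      by (simp add: chart_def)
    \<comment> \<open>The Hamiltonian identity evaluates \<open>?K\<close> at a transformed point.
      It is therefore applied at the image of \<open>(X, Y, Z, W)\<close>, which the involution
      sends back.\<close>
    from change_vars_involution[OF this, of A2 A4]
    show "?K X Y Z W t =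
        ?H (1 / X) (- (X * Y + A2) * X) (1 / Z) (- (Z * W + A4) * Z) t + ?e t"
      using H_S_tilde_change_vars[OF _ _ A, of "1 / X" "1 / Z" "- (X * Y + A2) * X"
          "- (Z * W + A4) * Z" t] \<open>X \<noteq> 0\<close> \<open>Z \<noteq> 0\<close>
      by simp
  qed (use sol phase_differentiable_H_S in \<open>simp_all add: old_params\<close>)
  \<comment> \<open>Conversely, the transport runs with the roles of \<open>?H\<close> and
    \<open>?K\<close> exchanged, so the shift enters with the opposite sign.\<close>
  show "solves_hamiltonian_system (H_S \<alpha>0 \<alpha>1 \<alpha>2 \<alpha>4 \<beta>2 \<beta>3 \<beta>4) U x y z w"
    if sol: "solves_hamiltonian_system ?K U X Y Z W"
    unfolding old_params
  proof (rule solves_hamiltonian_system_transport[OF time_domain(1) _ _ nz' old])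
    fix t x y z w :: complex
    assume "x \<noteq> 0" "z \<noteq> 0"
    then show "?H x y z w t =
        ?K (1 / x) (- (x * y + A2) * x) (1 / z) (- (z * w + A4) * z) t + - ?e t"
      using H_S_tilde_change_vars[OF _ _ A] by simp
  qed (use sol phase_differentiable_H_S_tilde in simp_all)
qed

end
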